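(* Let $H\in\mathbb{C}^{2m\times 2m}$ be a BSE matrix whose spectrum is contained in $[-1,1]$, and let $[\alpha,\beta]\subset[0,1]$. Then the matrix $$q_{[\alpha,\beta]}(H)=\sum_{n=0}^{N} g_n\,(c_n^+-c_n^-)\,T_n(H)$$ has BSE structure, i.e. it is again a BSE matrix.
   Context: BSE structure: a matrix $H\in\mathbb{C}^{2m\times 2m}$ is a BSE matrix (has BSE structure) if $H=\begin{bmatrix} R & C\\ -C^* & -R^T\end{bmatrix}$ with $R,C\in\mathbb{C}^{m\times m}$, $R=R^*$ and $C=C^T$, where $^*$ denotes conjugate transpose and $^T$ transpose. Chebyshev polynomials: $T_0(H)=I$, $T_1(H)=H$, $T_{n+1}(H)=2HT_n(H)-T_{n-1}(H)$. Coefficients: for $[a,b]\subset[-1,1]$, the Chebyshev coefficients of the indicator function of $[a,b]$ are $$c_0^{[a,b]}=\frac{\arccos(a)-\arccos(b)}{\pi},\qquad c_n^{[a,b]}=\frac{2\big(\sin(n\arccos(a))-\sin(n\arccos(b))\big)}{\pi n}\quad (n>0).$$ Put $c_n^+=c_n^{[\alpha,\beta]}$ and $c_n^-=c_n^{[-\beta,-\alpha]}$. The integer $N\ge 0$ is the polynomial degree (truncation order) and $g_0,\dots,g_N$ are real damping coefficients. With $p_{[a,b]}(H)=\sum_{n=0}^N g_n c_n^{[a,b]}T_n(H)$, one has $q_{[\alpha,\beta]}(H)=p_{[\alpha,\beta]}(H)-p_{[-\beta,-\alpha]}(H)$. *)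

theory Defs
  imports
    "HOL-Analysis.Analysis"
    "Jordan_Normal_Form.Schur_Decomposition"
    "Jordan_Normal_Form.Spectral_Radius"
begin

definition bse_matrix :: "nat \<Rightarrow> complex mat \<Rightarrow> bool" where
  "bse_matrix m H \<longleftrightarrow>
     (\<exists>R C. R \<in> carrier_mat m m \<and> C \<in> carrier_mat m m \<and>
            R = mat_adjoint R \<and> C = transpose_mat C \<and>
            H = four_block_mat R C (- mat_adjoint C) (- transpose_mat R))"

fun cheb_mat :: "nat \<Rightarrow> complex mat \<Rightarrow> complex mat" where
  "cheb_mat 0 H = 1\<^sub>m (dim_row H)"
| "cheb_mat (Suc 0) H = H"
| "cheb_mat (Suc (Suc n)) H = 2 \<cdot>\<^sub>m (H * cheb_mat (Suc n) H) - cheb_mat n H"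

definition cheb_coeff :: "real \<Rightarrow> real \<Rightarrow> nat \<Rightarrow> real" where
  "cheb_coeff a b n =
     (if n = 0 then (arccos a - arccos b) / pi
      else 2 * (sin (real n * arccos a) - sin (real n * arccos b)) / (pi * real n))"

text \<open>
  The type of matrices carries no additive monoid structure, so sums of square matrices of
  size \<open>d\<close> are taken in the module of \<open>d \<times> d\<close> matrices.
\<close>

definition cheb_sum :: "nat \<Rightarrow> (nat \<Rightarrow> real) \<Rightarrow> nat \<Rightarrow> complex mat \<Rightarrow> complex mat" where
  "cheb_sum d w N H =
     (\<Oplus>\<^bsub>module_mat TYPE(complex) d d\<^esub> n\<in>{..N}. complex_of_real (w n) \<cdot>\<^sub>m cheb_mat n H)"

definition filter_p :: "(nat \<Rightarrow> real) \<Rightarrow> nat \<Rightarrow> real \<Rightarrow> real \<Rightarrow> complex mat \<Rightarrow> complex mat" where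
  "filter_p g N a b H = cheb_sum (dim_row H) (\<lambda>n. g n * cheb_coeff a b n) N H"

definition filter_q :: "(nat \<Rightarrow> real) \<Rightarrow> nat \<Rightarrow> real \<Rightarrow> real \<Rightarrow> complex mat \<Rightarrow> complex mat" where
  "filter_q g N \<alpha> \<beta> H = filter_p g N \<alpha> \<beta> H - filter_p g N (- \<beta>) (- \<alpha>) H"

end

theory Submission
  imports Defs
begin

text \<open>
  With \<open>S = diag(I, -I)\<close> and \<open>K\<close> the swap of the two halves of \<open>\<complex>\<^bsup>2m\<^esup>\<close>, a matrix \<open>H\<close> is a BSE matrix
  iff \<open>S H\<^sup>* S = H\<close> and \<open>K H' K = - H\<close>, where \<open>H'\<close> is the entrywise complex conjugate. As
  \<open>X \<mapsto> S X\<^sup>* S\<close> is an antiautomorphism and \<open>X \<mapsto> K X' K\<close> an automorphism, both of them real-linear,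
  real polynomials in \<open>H\<close> inherit the first identity and odd ones also the second. Finally
  \<open>arccos (- x) = pi - arccos x\<close> makes \<open>c\<^sub>n\<^sup>+ - c\<^sub>n\<^sup>-\<close> vanish for even \<open>n\<close>, so only odd
  Chebyshev polynomials contribute.
\<close>

definition half_sgn :: "nat \<Rightarrow> nat \<Rightarrow> complex" where
  "half_sgn m i = (if i < m then 1 else -1)"

definition half_swap :: "nat \<Rightarrow> nat \<Rightarrow> nat" where
  "half_swap m i = (if i < m then i + m else i - m)"

text \<open>Entrywise form of \<open>S A^* S = A\<close>, with \<open>half_sgn\<close> giving the
  diagonal of \<open>S\<close>.\<close>

definition sgn_selfadjoint :: "nat \<Rightarrow> complex mat \<Rightarrow> bool" where
  "sgn_selfadjoint m A \<longleftrightarrow>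
     (\<forall>i<2*m. \<forall>j<2*m. cnj (A $$ (j, i)) = half_sgn m i * half_sgn m j * A $$ (i, j))"

text \<open>Entrywise form of \<open>K A' K = s A\<close>. The factor \<open>s\<close> stays a
  parameter because Chebyshev polynomials of both parities occur in the recursion.\<close>

definition swap_parity :: "nat \<Rightarrow> complex \<Rightarrow> complex mat \<Rightarrow> bool" where
  "swap_parity m s A \<longleftrightarrow>
     (\<forall>i<2*m. \<forall>j<2*m. cnj (A $$ (half_swap m i, half_swap m j)) = s * A $$ (i, j))"

lemma half_sgn_square [simp]: "half_sgn m i * half_sgn m i = 1" "half_sgn m i * (half_sgn m i * x) = x"
  by (simp_all add: half_sgn_def)

lemma half_swap_less: "i < 2 * m \<Longrightarrow> half_swap m i < 2 * m"
  by (auto simp: half_swap_def)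

lemma half_swap_eq_iff:
  "i < 2 * m \<Longrightarrow> j < 2 * m \<Longrightarrow> half_swap m i = half_swap m j \<longleftrightarrow> i = j"
  by (auto simp: half_swap_def)

lemma bij_betw_half_swap: "bij_betw (half_swap m) {..<2*m} {..<2*m}"
  by (rule bij_betw_byWitness[where f' = "half_swap m"]) (auto simp: half_swap_def)

lemma mat_mult_index_sum:
  assumes "A \<in> carrier_mat d d" "B \<in> carrier_mat d d" "i < d" "j < d"
  shows "(A * B) $$ (i, j) = (\<Sum>k<d. A $$ (i, k) * B $$ (k, j))"
  using assms by (auto simp: scalar_prod_def atLeast0LessThan intro!: sum.cong)

lemma mat_adjoint_index:
  assumes "A \<in> carrier_mat m n" "i < n" "j < m"
  shows "mat_adjoint A $$ (i, j) = cnj (A $$ (j, i))"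
  using assms by (simp add: mat_adjoint_def mat_of_rows_def)

lemma mat_adjoint_carrier:
  "A \<in> carrier_mat m n \<Longrightarrow> mat_adjoint A \<in> carrier_mat n m"
  by (auto simp: mat_adjoint_def)

text \<open>The first symmetry makes \<open>R\<close> Hermitian and the lower left block
  \<open>- C^*\<close>; the second makes the lower blocks the negated conjugates of \<open>C\<close>
  and \<open>R\<close>. Together they say that \<open>C\<close> is symmetric and the lower right
  block is \<open>- R^T\<close>.\<close>

lemma bse_matrix_iff:
  assumes H: "H \<in> carrier_mat (2 * m) (2 * m)"
  shows "bse_matrix m H \<longleftrightarrow> sgn_selfadjoint m H \<and> swap_parity m (-1) H"
proof
  assume "bse_matrix m H"
  then obtain R C where R: "R \<in> carrier_mat m m" and C: "C \<in> carrier_mat m m"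
    and Rh: "R = mat_adjoint R" and Cs: "C = transpose_mat C"
    and HE: "H = four_block_mat R C (- mat_adjoint C) (- transpose_mat R)"
    unfolding bse_matrix_def by blast
  have r: "cnj (R $$ (j, i)) = R $$ (i, j)" if "i < m" "j < m" for i j
    using mat_adjoint_index[OF R that] Rh by simp
  have c: "C $$ (j, i) = C $$ (i, j)" if "i < m" "j < m" for i j
    using that C by (subst Cs) simp
  note dims = R C mat_adjoint_carrier[OF C]
  have ent: "H $$ (i, j) =
      (if i < m then if j < m then R $$ (i, j) else C $$ (i, j - m)
       else if j < m then - cnj (C $$ (j, i - m)) else - R $$ (j - m, i - m))"
    if "i < 2*m" "j < 2*m" for i j
    using that dims unfolding HE by (auto simp: mat_adjoint_index)
  show "sgn_selfadjoint m H \<and> swap_parity m (-1) H"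
    unfolding sgn_selfadjoint_def swap_parity_def
    \<comment> \<open>\<open>half_swap\<close> stays folded in the first pass, so that
      \<open>half_swap_less\<close> discharges the bounds required by \<open>ent\<close>.\<close>
    by (auto simp: ent half_swap_less)
       (auto simp: half_sgn_def half_swap_def r c)
next
  assume "sgn_selfadjoint m H \<and> swap_parity m (-1) H"
  then have sa: "\<And>i j. i < 2*m \<Longrightarrow> j < 2*m \<Longrightarrow>
        cnj (H $$ (j, i)) = half_sgn m i * half_sgn m j * H $$ (i, j)"
    and sp: "\<And>i j. i < 2*m \<Longrightarrow> j < 2*m \<Longrightarrow> cnj (H $$ (half_swap m i, half_swap m j)) = - H $$ (i, j)"
    unfolding sgn_selfadjoint_def swap_parity_def by auto
  define R where "R = mat m m (\<lambda>(i, j). H $$ (i, j))"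
  define C where "C = mat m m (\<lambda>(i, j). H $$ (i, j + m))"
  have R: "R \<in> carrier_mat m m" and C: "C \<in> carrier_mat m m"
    by (auto simp: R_def C_def)
  have low: "H $$ (i + m, j) = - cnj (H $$ (j, i + m))" if "i < m" "j < m" for i j
    using sa[of "i + m" j] that by (simp add: half_sgn_def)
  have neg: "H $$ (i + m, j + m) = - H $$ (j, i)" if "i < m" "j < m" for i j
    using sa[of j i] sp[of "i + m" "j + m"] that by (simp add: half_sgn_def half_swap_def)
  \<comment> \<open>The lower left block is \<open>- C^*\<close> by \<open>low\<close> and
    \<open>- C'\<close> by \<open>sp\<close>; comparing the two gives the symmetry of
    \<open>C\<close>.\<close>
  have sym: "H $$ (j, i + m) = H $$ (i, j + m)" if "i < m" "j < m" for i j
    using sp[of i "j + m"] low[of i j] that by (simp add: half_swap_def)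
  have "R = mat_adjoint R"
    using R mat_adjoint_carrier[OF R] sa
    by (intro eq_matI) (auto simp: mat_adjoint_index[OF R], auto simp: R_def half_sgn_def)
  moreover have "C = transpose_mat C"
    using C by (intro eq_matI) (auto simp: C_def sym)
  moreover have "H = four_block_mat R C (- mat_adjoint C) (- transpose_mat R)"
  proof (rule eq_matI)
    fix i j
    assume "i < dim_row (four_block_mat R C (- mat_adjoint C) (- transpose_mat R))"
      "j < dim_col (four_block_mat R C (- mat_adjoint C) (- transpose_mat R))"
    then have ij: "i < 2*m" "j < 2*m" using R C by auto
    then show "H $$ (i, j) = four_block_mat R C (- mat_adjoint C) (- transpose_mat R) $$ (i, j)"
      using R C mat_adjoint_carrier[OF C] low[of "i - m" j] neg[of "i - m" "j - m"]
      by (auto simp: mat_adjoint_index) (auto simp: R_def C_def)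
  qed (use H R C in auto)
  ultimately show "bse_matrix m H"
    using R C unfolding bse_matrix_def by blast
qed

text \<open>The antiautomorphism sends \<open>A * B\<close> to \<open>B * A\<close>, so commutation
  is what closes the argument. The signs at the summation index cancel in pairs.\<close>

lemma sgn_selfadjoint_mult:
  assumes A: "A \<in> carrier_mat (2*m) (2*m)" and B: "B \<in> carrier_mat (2*m) (2*m)"
    and comm: "A * B = B * A" and sA: "sgn_selfadjoint m A" and sB: "sgn_selfadjoint m B"
  shows "sgn_selfadjoint m (A * B)"
  unfolding sgn_selfadjoint_def
proof (intro allI impI)
  fix i j assume ij: "i < 2*m" "j < 2*m"
  have "cnj ((A * B) $$ (j, i)) = (\<Sum>k<2*m. cnj (A $$ (j, k)) * cnj (B $$ (k, i)))"
    using A B ij by (subst mat_mult_index_sum) auto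
  also have "\<dots> = (\<Sum>k<2*m. half_sgn m i * half_sgn m j * (B $$ (i, k) * A $$ (k, j)))"
    using sA sB ij unfolding sgn_selfadjoint_def
    by (intro sum.cong) (auto simp: algebra_simps)
  also have "\<dots> = half_sgn m i * half_sgn m j * (B * A) $$ (i, j)"
    using A B ij by (subst mat_mult_index_sum) (auto simp: sum_distrib_left)
  finally show "cnj ((A * B) $$ (j, i)) = half_sgn m i * half_sgn m j * (A * B) $$ (i, j)"
    by (simp add: comm)
qed

lemma swap_parity_mult:
  assumes A: "A \<in> carrier_mat (2*m) (2*m)" and B: "B \<in> carrier_mat (2*m) (2*m)"
    and sA: "swap_parity m s A" and sB: "swap_parity m t B"
  shows "swap_parity m (s * t) (A * B)"
  unfolding swap_parity_def
proof (intro allI impI)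
  fix i j assume ij: "i < 2*m" "j < 2*m"
  let ?h = "half_swap m"
  have "cnj ((A * B) $$ (?h i, ?h j)) = (\<Sum>k<2*m. cnj (A $$ (?h i, k)) * cnj (B $$ (k, ?h j)))"
    using A B ij by (subst mat_mult_index_sum) (auto simp: half_swap_less)
  \<comment> \<open>Permuting the summation index amounts to inserting \<open>K K = I\<close>
    between the two factors.\<close>
  also have "\<dots> = (\<Sum>k<2*m. cnj (A $$ (?h i, ?h k)) * cnj (B $$ (?h k, ?h j)))"
    by (rule sum.reindex_bij_betw[OF bij_betw_half_swap, symmetric])
  also have "\<dots> = (\<Sum>k<2*m. s * t * (A $$ (i, k) * B $$ (k, j)))"
    using sA sB ij unfolding swap_parity_def by (intro sum.cong) (auto simp: algebra_simps)
  also have "\<dots> = s * t * (A * B) $$ (i, j)"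
    using A B ij by (subst mat_mult_index_sum) (auto simp: sum_distrib_left)
  finally show "cnj ((A * B) $$ (?h i, ?h j)) = s * t * (A * B) $$ (i, j)" .
qed

lemma cheb_mat_carrier:
  "H \<in> carrier_mat d d \<Longrightarrow> cheb_mat n H \<in> carrier_mat d d"
  by (induction n H rule: cheb_mat.induct) auto

text \<open>Supplies the commutation hypothesis of \<open>sgn_selfadjoint_mult\<close> for the
  products in the Chebyshev recursion.\<close>

lemma cheb_mat_commute:
  assumes H: "H \<in> carrier_mat d d"
  shows "H * cheb_mat n H = cheb_mat n H * H"
  using H
proof (induction n H rule: cheb_mat.induct)
  case (3 n H)
  note T = cheb_mat_carrier[OF "3.prems"]
  define X where "X = H * cheb_mat (Suc n) H"
  define Y where "Y = cheb_mat n H"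
  have X: "X \<in> carrier_mat d d" and Y: "Y \<in> carrier_mat d d"
    using T "3.prems" by (auto simp: X_def Y_def)
  have HX: "H * X = X * H"
    unfolding X_def assoc_mult_mat[OF "3.prems" T "3.prems"] using 3 by simp
  have HY: "H * Y = Y * H"
    using 3 by (simp add: Y_def)
  have "H * (2 \<cdot>\<^sub>m X - Y) = 2 \<cdot>\<^sub>m (H * X) - H * Y"
    using X Y "3.prems" by (simp add: mult_minus_distrib_mat[of H d d _ d] mult_smult_distrib)
  also have "\<dots> = (2 \<cdot>\<^sub>m X - Y) * H"
    using X Y "3.prems"
    by (simp add: HX HY minus_mult_distrib_mat[of _ d d _ H d] mult_smult_assoc_mat)
  finally show ?case
    by (simp add: X_def Y_def)
qed auto

lemma sgn_selfadjoint_cheb_mat: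
  assumes "H \<in> carrier_mat (2*m) (2*m)" "sgn_selfadjoint m H"
  shows "sgn_selfadjoint m (cheb_mat n H)"
  using assms
proof (induction n H rule: cheb_mat.induct)
  case (1 H)
  then show ?case by (auto simp: sgn_selfadjoint_def)
next
  case (3 n H)
  note T = cheb_mat_carrier[OF "3.prems"(1)]
  have "sgn_selfadjoint m (H * cheb_mat (Suc n) H)"
    using 3 T cheb_mat_commute by (intro sgn_selfadjoint_mult) auto
  then show ?case
    using 3 T[of n] T[of "Suc n"]
    \<comment> \<open>Entries of the product stay unexpanded, so that its own symmetry applies to
      them; the factor 2 is real and passes through \<open>cnj\<close>.\<close>
    unfolding sgn_selfadjoint_def by (simp add: right_diff_distrib del: index_mult_mat(1))
qed simp

text \<open>Multiplying by \<open>H\<close> flips the parity, so both terms of the recursion for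
  degree \<open>n + 2\<close> have parity \<open>(-1) ^ n\<close>.\<close>

lemma swap_parity_cheb_mat:
  assumes "H \<in> carrier_mat (2*m) (2*m)" "swap_parity m (-1) H"
  shows "swap_parity m ((-1) ^ n) (cheb_mat n H)"
  using assms
proof (induction n H rule: cheb_mat.induct)
  case (1 H)
  then show ?case by (auto simp: swap_parity_def half_swap_less half_swap_eq_iff)
next
  case (3 n H)
  note T = cheb_mat_carrier[OF "3.prems"(1)]
  have "swap_parity m (-1 * (-1) ^ Suc n) (H * cheb_mat (Suc n) H)"
    using 3 T by (intro swap_parity_mult) auto
  then show ?case
    using 3 T[of n] T[of "Suc n"]
    unfolding swap_parity_def
    by (simp add: half_swap_less right_diff_distrib del: index_mult_mat(1))
qed simp

text \<open>Turns the module sum into ordinary complex sums of entries, the form in which both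
  symmetries are stated.\<close>

lemma cheb_sum_carrier_index:
  assumes H: "H \<in> carrier_mat d d"
  shows "cheb_sum d w N H \<in> carrier_mat d d"
    and "i < d \<Longrightarrow> j < d \<Longrightarrow>
      cheb_sum d w N H $$ (i, j) = (\<Sum>n\<le>N. complex_of_real (w n) * cheb_mat n H $$ (i, j))"
proof -
  interpret M: abelian_monoid "module_mat TYPE(complex) d d"
    using abelian_group_mat abelian_group_def by blast
  let ?f = "\<lambda>n. complex_of_real (w n) \<cdot>\<^sub>m cheb_mat n H"
  have f: "?f n \<in> carrier_mat d d" for n
    using cheb_mat_carrier[OF H] by simp
  have Suc: "cheb_sum d w (Suc N) H = ?f (Suc N) + cheb_sum d w N H" for N
    using f unfolding cheb_sum_def atMost_Suc
    by (subst M.finsum_insert) (auto simp: module_mat_simps)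
  have zero: "cheb_sum d w 0 H = ?f 0"
    using f[of 0] M.finsum_insert[of "{}" 0 ?f] unfolding cheb_sum_def
    by (auto simp: module_mat_simps)
  have carr: "cheb_sum d w N H \<in> carrier_mat d d" for N
    using f[of 0] f[of "Suc _"] by (induction N) (auto simp: zero Suc)
  then show "cheb_sum d w N H \<in> carrier_mat d d" .
  show "cheb_sum d w N H $$ (i, j) = (\<Sum>n\<le>N. complex_of_real (w n) * cheb_mat n H $$ (i, j))"
    if "i < d" "j < d"
  proof (induction N)
    case 0
    then show ?case using cheb_mat_carrier[OF H, of 0] that by (simp add: zero del: cheb_mat.simps)
  next
    case (Suc N)
    then show ?case
      using cheb_mat_carrier[OF H, of "Suc N"] carr[of N] that
      by (simp add: Suc \<open>\<And>N. cheb_sum d w (Suc N) H = _\<close> del: cheb_mat.simps)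
  qed
qed

text \<open>Reflecting the interval swaps the endpoints and replaces each angle \<open>x\<close> by
  \<open>pi - x\<close>. For even \<open>n\<close> the latter negates the sine, which undoes the
  swap; for \<open>n = 0\<close> the two copies of \<open>pi\<close> cancel.\<close>

lemma cheb_coeff_reflect_even:
  assumes "\<bar>a\<bar> \<le> 1" "\<bar>b\<bar> \<le> 1" "even n"
  shows "cheb_coeff (- b) (- a) n = cheb_coeff a b n"
proof -
  have "sin (real n * (pi - x)) = - sin (real n * x)" for x
    using \<open>even n\<close> by (simp add: right_diff_distrib sin_diff)
  then show ?thesis
    using assms by (simp add: cheb_coeff_def arccos_minus abs_le_iff)
qed

lemma bse_matrix_cheb_sum_odd:
  assumes H: "H \<in> carrier_mat (2*m) (2*m)" and bse: "bse_matrix m H"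
    and even: "\<And>n. even n \<Longrightarrow> w n = 0"
  shows "bse_matrix m (cheb_sum (2*m) w N H)"
proof -
  note ent = cheb_sum_carrier_index(2)[OF H]
  have sa: "sgn_selfadjoint m (cheb_mat n H)" and sp: "swap_parity m ((-1)^n) (cheb_mat n H)" for n
    using bse bse_matrix_iff[OF H] H
    by (auto intro: sgn_selfadjoint_cheb_mat swap_parity_cheb_mat)
  have "sgn_selfadjoint m (cheb_sum (2*m) w N H)"
    using sa unfolding sgn_selfadjoint_def
    by (auto simp: ent sum_distrib_left mult.left_commute intro!: sum.cong)
  moreover have "swap_parity m (-1) (cheb_sum (2*m) w N H)"
    unfolding swap_parity_def
  proof (intro allI impI)
    fix i j assume ij: "i < 2*m" "j < 2*m"
    \<comment> \<open>For even \<open>n\<close> both sides vanish with the weight; for odd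
      \<open>n\<close> the parity is -1.\<close>
    have "of_real (w n) * cnj (cheb_mat n H $$ (half_swap m i, half_swap m j))
        = - (of_real (w n) * cheb_mat n H $$ (i, j))" for n
      using sp[of n] even[of n] ij unfolding swap_parity_def by (cases "even n") auto
    then show "cnj (cheb_sum (2*m) w N H $$ (half_swap m i, half_swap m j))
        = -1 * cheb_sum (2*m) w N H $$ (i, j)"
      using ij by (simp add: ent half_swap_less sum_negf)
  qed
  ultimately show ?thesis
    using bse_matrix_iff[OF cheb_sum_carrier_index(1)[OF H]] by blast
qed

theorem theorem1:
  fixes m N :: nat and H :: "complex mat" and g :: "nat \<Rightarrow> real" and \<alpha> \<beta> :: real
  assumes "H \<in> carrier_mat (2 * m) (2 * m)"
    and "bse_matrix m H"
    and "spectrum H \<subseteq> complex_of_real ` {-1..1}"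
    and "0 \<le> \<alpha>" and "\<alpha> \<le> \<beta>" and "\<beta> \<le> 1"
  shows "filter_q g N \<alpha> \<beta> H =
           cheb_sum (2 * m) (\<lambda>n. g n * (cheb_coeff \<alpha> \<beta> n - cheb_coeff (- \<beta>) (- \<alpha>) n)) N H
         \<and> bse_matrix m (filter_q g N \<alpha> \<beta> H)"
proof -
  let ?w = "\<lambda>n. g n * (cheb_coeff \<alpha> \<beta> n - cheb_coeff (- \<beta>) (- \<alpha>) n)"
  note [simp] = carrier_matD[OF cheb_sum_carrier_index(1)[OF assms(1)]]
  note cs = cheb_sum_carrier_index[OF assms(1)]
  have row: "dim_row H = 2 * m" using assms(1) by simp
  \<comment> \<open>Entrywise, the difference of the two filters merges into one sum, whose weights
    vanish at even \<open>n\<close>.\<close>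
  have eq: "filter_q g N \<alpha> \<beta> H = cheb_sum (2 * m) ?w N H"
    unfolding filter_q_def filter_p_def row
  proof (rule eq_matI, goal_cases)
    case (1 i j)
    then have ij: "i < 2*m" "j < 2*m" using cs(1)[of ?w N] by auto
    then show ?case
      using cs(1)[of "\<lambda>n. g n * cheb_coeff \<alpha> \<beta> n" N]
        cs(1)[of "\<lambda>n. g n * cheb_coeff (- \<beta>) (- \<alpha>) n" N]
      by (simp add: cs(2) left_diff_distrib right_diff_distrib sum_subtractf)
  qed simp_all
  have "?w n = 0" if "even n" for n
    using that assms(4-6) cheb_coeff_reflect_even[of \<alpha> \<beta> n] by simp
  then show ?thesis
    using eq bse_matrix_cheb_sum_odd[OF assms(1,2), of ?w N] by simp
qed

end
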